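(* Let $G$ be a finitely generated group and let $X$ be a finite symmetric generating set of $G$. If $\mathrm{Geo}(G,X)$ is a recursive subset of $X^*$ and $G$ has a recursively enumerable presentation, then $G$ has solvable word problem.
   Context: A generating set $X$ of a group $G$ is symmetric if it is closed under taking inverses. $X^*$ is the set of all words over $X$, and $\mathrm{Geo}(G,X)\subseteq X^*$ denotes the set of all words over $X$ that label geodesic paths in the Cayley graph of $G$ with respect to $X$, i.e. the words $w$ such that no strictly shorter word over $X$ represents the same element of $G$ as $w$. *)

theory Defs
  imports "HOL-Algebra.Generated_Groups" "HOL-Library.Nat_Bijection"
begin

section \<open>Recursive functions and sets\<close>

text \<open>
  The total recursive functions of arity \<open>n\<close> (Shoenfield's definition: minimization is applied to
  regular functions only). An \<open>n\<close>-ary function is represented as a function on lists, and only its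
  values on lists of length \<open>n\<close> are meaningful. In \<open>prim_rec\<close> the recursion argument comes first.
\<close>

inductive recursive_fn :: "nat \<Rightarrow> (nat list \<Rightarrow> nat) \<Rightarrow> bool" where
  zero: "recursive_fn n (\<lambda>xs. 0)"
| succ: "recursive_fn 1 (\<lambda>xs. Suc (xs ! 0))"
| proj: "i < n \<Longrightarrow> recursive_fn n (\<lambda>xs. xs ! i)"
| comp: "recursive_fn (length gs) f \<Longrightarrow> \<forall>g\<in>set gs. recursive_fn n g \<Longrightarrow>
    recursive_fn n (\<lambda>xs. f (map (\<lambda>g. g xs) gs))"
| prim_rec: "recursive_fn n f \<Longrightarrow> recursive_fn (Suc (Suc n)) g \<Longrightarrow>
    recursive_fn (Suc n) (\<lambda>xs. rec_nat (f (tl xs)) (\<lambda>k r. g (k # r # tl xs)) (hd xs))"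
| minim: "recursive_fn (Suc n) f \<Longrightarrow> \<forall>xs. length xs = n \<longrightarrow> (\<exists>y. f (y # xs) = 0) \<Longrightarrow>
    recursive_fn n (\<lambda>xs. LEAST y. f (y # xs) = 0)"

definition recursive_set :: "nat set \<Rightarrow> bool" where
  "recursive_set A \<longleftrightarrow> (\<exists>f. recursive_fn 1 f \<and> (\<forall>n. f [n] = (if n \<in> A then 1 else 0)))"

definition re_set :: "nat set \<Rightarrow> bool" where
  "re_set A \<longleftrightarrow> A = {} \<or> (\<exists>f. recursive_fn 1 f \<and> A = range (\<lambda>n. f [n]))"

text \<open>
  Recursiveness of a language over a finite alphabet \<open>X\<close>. Words are coded as numbers via a numbering
  of the letters; as any two numberings of a finite set differ by a (recursive) finite permutation,
  the notion does not depend on the one chosen.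
\<close>

definition recursive_language :: "'a set \<Rightarrow> 'a list set \<Rightarrow> bool" where
  "recursive_language X L \<longleftrightarrow> L \<subseteq> lists X \<and>
    (\<exists>e. bij_betw e X {..<card X} \<and> recursive_set ((\<lambda>w. list_encode (map e w)) ` L))"


section \<open>Presentations\<close>

text \<open>
  Letters of group words are pairs: \<open>(s, True)\<close> is the generator \<open>s\<close> and \<open>(s, False)\<close> its formal
  inverse.
\<close>

inductive_set free_equiv :: "'s set \<Rightarrow> (('s \<times> bool) list \<times> ('s \<times> bool) list) set"
  for S :: "'s set" where
  refl: "w \<in> lists (S \<times> UNIV) \<Longrightarrow> (w, w) \<in> free_equiv S"
| sym: "(v, w) \<in> free_equiv S \<Longrightarrow> (w, v) \<in> free_equiv S"
| trans: "(u, v) \<in> free_equiv S \<Longrightarrow> (v, w) \<in> free_equiv S \<Longrightarrow> (u, w) \<in> free_equiv S"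
| cancel: "u \<in> lists (S \<times> UNIV) \<Longrightarrow> v \<in> lists (S \<times> UNIV) \<Longrightarrow> s \<in> S \<Longrightarrow>
    (u @ [(s, b), (s, \<not> b)] @ v, u @ v) \<in> free_equiv S"

definition free_group :: "'s set \<Rightarrow> ('s \<times> bool) list set monoid" where
  "free_group S =
    \<lparr>carrier = lists (S \<times> UNIV) // free_equiv S,
     mult = (\<lambda>A B. free_equiv S `` {u @ v | u v. u \<in> A \<and> v \<in> B}),
     one = free_equiv S `` {[]}\<rparr>"

definition normal_closure :: "('a, 'b) monoid_scheme \<Rightarrow> 'a set \<Rightarrow> 'a set" where
  "normal_closure G R = \<Inter> {N. N \<lhd> G \<and> R \<subseteq> N}"

definition presented_group ::
    "'s set \<Rightarrow> ('s \<times> bool) list set \<Rightarrow> ('s \<times> bool) list set set monoid" where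
  "presented_group S R =
    free_group S Mod normal_closure (free_group S) ((\<lambda>r. free_equiv S `` {r}) ` R)"

text \<open>
  The generators of a recursively enumerable presentation are taken to be natural numbers. The set of
  generators is only required to be recursively enumerable; every finite set is.
\<close>

definition word_code :: "(nat \<times> bool) list \<Rightarrow> nat" where
  "word_code w = list_encode (map (\<lambda>(s, b). 2 * s + of_bool b) w)"

definition has_re_presentation :: "('a, 'b) monoid_scheme \<Rightarrow> bool" where
  "has_re_presentation G \<longleftrightarrow>
    (\<exists>(S :: nat set) R. re_set S \<and> R \<subseteq> lists (S \<times> UNIV) \<and> re_set (word_code ` R) \<and>
      G \<cong> presented_group S R)"


section \<open>Geodesics and the word problem\<close>

definition finite_symmetric_generating_set :: "('a, 'b) monoid_scheme \<Rightarrow> 'a set \<Rightarrow> bool" where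
  "finite_symmetric_generating_set G X \<longleftrightarrow>
    finite X \<and> X \<subseteq> carrier G \<and> (\<forall>x\<in>X. inv\<^bsub>G\<^esub> x \<in> X) \<and> generate G X = carrier G"

definition word_value :: "('a, 'b) monoid_scheme \<Rightarrow> 'a list \<Rightarrow> 'a" where
  "word_value G w = foldr (\<otimes>\<^bsub>G\<^esub>) w \<one>\<^bsub>G\<^esub>"

definition Geo :: "('a, 'b) monoid_scheme \<Rightarrow> 'a set \<Rightarrow> 'a list set" where
  "Geo G X = {w \<in> lists X. \<not> (\<exists>v\<in>lists X. length v < length w \<and> word_value G v = word_value G w)}"

definition word_problem :: "('a, 'b) monoid_scheme \<Rightarrow> 'a set \<Rightarrow> 'a list set" where
  "word_problem G X = {w \<in> lists X. word_value G w = \<one>\<^bsub>G\<^esub>}"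

text \<open>
  Solvability of the word problem does not depend on the finite generating set, so it is demanded for
  all of them; the first conjunct excludes groups that are not finitely generated.
\<close>

definition solvable_word_problem :: "('a, 'b) monoid_scheme \<Rightarrow> bool" where
  "solvable_word_problem G \<longleftrightarrow>
    (\<exists>X. finite_symmetric_generating_set G X) \<and>
    (\<forall>X. finite_symmetric_generating_set G X \<longrightarrow> recursive_language X (word_problem G X))"

end

theory Submission
  imports Defs "HOL-Library.Confluence"
begin

text \<open>
  Every element of \<open>G\<close> is represented by a geodesic over \<open>X\<close>, and the only geodesic representing the
  identity is the empty word. So a word \<open>w\<close> is decided by looking for a geodesic \<open>u\<close> with \<open>u = w\<close> in
  \<open>G\<close>: the search always succeeds, and \<open>w\<close> represents the identity iff the \<open>u\<close> found is empty. The
  search is effective because membership in \<open>Geo G X\<close> is decidable and because an equation that holds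
  in \<open>G\<close> has a finite certificate with decidable correctness, which is searched for together with \<open>u\<close>.

  The certificates come from the presentation
  (\<open>re_presentation_semidecides_equality\<close>). Two words over the generators are equal in the presented
  group iff they are connected by insertions and deletions of relators, the words \<open>s s\<inverse>\<close> and
  \<open>s\<inverse> s\<close> being counted as relators (\<open>presented_group_words\<close>). Insertions alone have the diamond property
  (\<open>strong_confluentp_insertion\<close>), so by the Church-Rosser property two such words have a common descendant
  under insertions, and a certificate consists of two lists of insertions leading to it. Applying
  insertions is a total operation and needs no matching of relators inside a word; an insertion is
  coded by a position and an index in an enumeration of the relators.

  The word \<open>w\<close> need not be a word over \<open>X\<close>: if \<open>Y\<close> is any finite subset of \<open>G\<close>, its letters are
  replaced by words over the presentation's generators, and likewise the letters of \<open>u\<close>. Hence the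
  same search decides the word problem for all finite generating sets
  (\<open>recursive_word_problem\<close>), without a separate argument for changing the generators.

  That all this can be done by recursive functions is shown by closure properties of \<open>computable\<close>,
  a notion of recursive function between types whose elements are coded bijectively by numbers.
  Given these properties, an algorithm on lists is verified by writing it as a HOL function.
\<close>

section \<open>Recursive functions up to values on lists of the right length\<close>

text \<open>
  The predicate \<open>recursive_fn n\<close> may distinguish functions that differ only at lists whose length is not
  \<open>n\<close>. Closing it under agreement on lists of length \<open>n\<close> makes equational reasoning about recursive
  functions possible.
\<close>

definition recursive_on :: "nat \<Rightarrow> (nat list \<Rightarrow> nat) \<Rightarrow> bool" where
  "recursive_on n f \<longleftrightarrow> (\<exists>g. recursive_fn n g \<and> (\<forall>xs. length xs = n \<longrightarrow> g xs = f xs))"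

lemma recursive_onI: "recursive_fn n f \<Longrightarrow> recursive_on n f"
  unfolding recursive_on_def by blast

lemma recursive_on_cong:
  assumes "recursive_on n f" "\<And>xs. length xs = n \<Longrightarrow> f xs = g xs"
  shows "recursive_on n g"
  using assms unfolding recursive_on_def by metis

lemma recursive_on_nth: "i < n \<Longrightarrow> recursive_on n (\<lambda>xs. xs ! i)"
  by (intro recursive_onI recursive_fn.proj)

lemma recursive_on_comp1:
  assumes "recursive_on 1 f" "recursive_on n g"
  shows "recursive_on n (\<lambda>xs. f [g xs])"
proof -
  from assms obtain f' g' where f': "recursive_fn 1 f'" "\<And>xs. length xs = 1 \<Longrightarrow> f' xs = f xs"
    and g': "recursive_fn n g'" "\<And>xs. length xs = n \<Longrightarrow> g' xs = g xs"
    unfolding recursive_on_def by blast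
  have "recursive_fn n (\<lambda>xs. f' (map (\<lambda>g. g xs) [g']))"
    using f'(1) g'(1) by (intro recursive_fn.comp) auto
  then show ?thesis
    by (rule recursive_on_cong[OF recursive_onI]) (simp add: f'(2) g'(2))
qed

lemma recursive_on_comp2:
  assumes "recursive_on 2 f" "recursive_on n g" "recursive_on n h"
  shows "recursive_on n (\<lambda>xs. f [g xs, h xs])"
proof -
  from assms obtain f' g' h' where f': "recursive_fn 2 f'" "\<And>xs. length xs = 2 \<Longrightarrow> f' xs = f xs"
    and g': "recursive_fn n g'" "\<And>xs. length xs = n \<Longrightarrow> g' xs = g xs"
    and h': "recursive_fn n h'" "\<And>xs. length xs = n \<Longrightarrow> h' xs = h xs"
    unfolding recursive_on_def by blast
  have "recursive_fn n (\<lambda>xs. f' (map (\<lambda>g. g xs) [g', h']))"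
    using f'(1) g'(1) h'(1) by (intro recursive_fn.comp) (auto simp: numeral_2_eq_2)
  then show ?thesis
    by (rule recursive_on_cong[OF recursive_onI]) (simp add: f'(2) g'(2) h'(2))
qed

lemma recursive_on_Suc: "recursive_on n f \<Longrightarrow> recursive_on n (\<lambda>xs. Suc (f xs))"
  using recursive_on_comp1[OF recursive_onI[OF recursive_fn.succ]] by simp

lemma recursive_on_const: "recursive_on n (\<lambda>xs. c)"
  by (induction c) (auto intro: recursive_onI recursive_fn.zero recursive_on_Suc)

lemma recursive_on_rec_nat:
  assumes "recursive_on n f" "recursive_on (Suc (Suc n)) g"
  shows "recursive_on (Suc n) (\<lambda>xs. rec_nat (f (tl xs)) (\<lambda>k r. g (k # r # tl xs)) (hd xs))"
proof -
  from assms obtain f' g' where f': "recursive_fn n f'" "\<And>xs. length xs = n \<Longrightarrow> f' xs = f xs"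
    and g': "recursive_fn (Suc (Suc n)) g'" "\<And>xs. length xs = Suc (Suc n) \<Longrightarrow> g' xs = g xs"
    unfolding recursive_on_def by blast
  show ?thesis
    by (rule recursive_on_cong[OF recursive_onI[OF recursive_fn.prim_rec[OF f'(1) g'(1)]]])
      (simp add: f'(2) g'(2))
qed

lemma recursive_on_Least:
  assumes "recursive_on (Suc n) f" "\<And>xs. length xs = n \<Longrightarrow> \<exists>y. f (y # xs) = 0"
  shows "recursive_on n (\<lambda>xs. LEAST y. f (y # xs) = 0)"
proof -
  from assms(1) obtain f' where f': "recursive_fn (Suc n) f'"
      "\<And>xs. length xs = Suc n \<Longrightarrow> f' xs = f xs"
    unfolding recursive_on_def by blast
  have "recursive_fn n (\<lambda>xs. LEAST y. f' (y # xs) = 0)"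
    using f'(1) by (rule recursive_fn.minim) (simp add: f'(2) assms(2))
  then show ?thesis
    by (rule recursive_on_cong[OF recursive_onI]) (simp add: f'(2))
qed

lemma recursive_on_pred: "recursive_on 1 (\<lambda>xs. hd xs - 1)"
proof -
  have "recursive_on (Suc 0) (\<lambda>xs. rec_nat 0 (\<lambda>k r. (k # r # tl xs) ! 0) (hd xs))"
    by (rule recursive_on_rec_nat[OF recursive_on_const recursive_on_nth]) simp
  moreover have "rec_nat 0 (\<lambda>k r. k) a = a - 1" for a :: nat
    by (cases a) auto
  ultimately show ?thesis
    by simp
qed

lemma recursive_on_binary_rec:
  assumes "recursive_on 1 f" "recursive_on 3 g"
  shows "recursive_on 2 (\<lambda>xs. rec_nat (f [xs ! 1]) (\<lambda>k r. g [k, r, xs ! 1]) (xs ! 0))"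
proof -
  have "recursive_on (Suc 1) (\<lambda>xs. rec_nat (f (tl xs)) (\<lambda>k r. g (k # r # tl xs)) (hd xs))"
    using assms by (intro recursive_on_rec_nat) (simp_all add: numeral_3_eq_3)
  then show ?thesis
    unfolding Suc_1
    by (rule recursive_on_cong) (auto simp: numeral_2_eq_2 length_Suc_conv)
qed

lemma recursive_on_add:
  assumes "recursive_on n f" "recursive_on n g"
  shows "recursive_on n (\<lambda>xs. f xs + g xs)"
proof -
  have "recursive_on 2 (\<lambda>xs. rec_nat ([xs ! 1] ! 0) (\<lambda>k r. Suc ([k, r, xs ! 1] ! 1)) (xs ! 0))"
    by (rule recursive_on_binary_rec[of "\<lambda>xs. xs ! 0" "\<lambda>xs. Suc (xs ! 1)"])
      (intro recursive_on_Suc recursive_on_nth, simp)+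
  moreover have "rec_nat b (\<lambda>k r. Suc r) a = a + b" for a b
    by (induction a) auto
  ultimately have "recursive_on 2 (\<lambda>xs. xs ! 0 + xs ! 1)"
    by simp
  from recursive_on_comp2[OF this assms] show ?thesis by simp
qed

lemma recursive_on_diff:
  assumes "recursive_on n f" "recursive_on n g"
  shows "recursive_on n (\<lambda>xs. f xs - g xs)"
proof -
  have "recursive_on 2 (\<lambda>xs. rec_nat ([xs ! 1] ! 0) (\<lambda>k r. hd [[k, r, xs ! 1] ! 1] - 1) (xs ! 0))"
    by (rule recursive_on_binary_rec[of "\<lambda>xs. xs ! 0" "\<lambda>xs. hd [xs ! 1] - 1"])
      (intro recursive_on_comp1[OF recursive_on_pred] recursive_on_nth, simp)+
  moreover have "rec_nat b (\<lambda>k r. r - Suc 0) a = b - a" for a b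
    by (induction a) auto
  ultimately have "recursive_on 2 (\<lambda>xs. xs ! 1 - xs ! 0)"
    by simp
  from recursive_on_comp2[OF this assms(2,1)] show ?thesis by simp
qed

lemma recursive_on_mult:
  assumes "recursive_on n f" "recursive_on n g"
  shows "recursive_on n (\<lambda>xs. f xs * g xs)"
proof -
  have "recursive_on 2 (\<lambda>xs. rec_nat ((\<lambda>_. 0) [xs ! 1])
      (\<lambda>k r. [k, r, xs ! 1] ! 1 + [k, r, xs ! 1] ! 2) (xs ! 0))"
    by (rule recursive_on_binary_rec[of "\<lambda>_. 0" "\<lambda>xs. xs ! 1 + xs ! 2"])
      (intro recursive_on_add recursive_on_nth recursive_on_const; simp)+
  moreover have "rec_nat 0 (\<lambda>k r. r + b) a = a * b" for a b :: nat
    by (induction a) auto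
  ultimately have "recursive_on 2 (\<lambda>xs. xs ! 0 * xs ! 1)"
    by simp
  from recursive_on_comp2[OF this assms] show ?thesis by simp
qed

lemma recursive_on_triangle:
  assumes "recursive_on n f"
  shows "recursive_on n (\<lambda>xs. triangle (f xs))"
proof -
  have "recursive_on (Suc 0) (\<lambda>xs. rec_nat 0 (\<lambda>k r. (k # r # tl xs) ! 1 + Suc ((k # r # tl xs) ! 0)) (hd xs))"
    by (rule recursive_on_rec_nat[OF recursive_on_const, of _ "\<lambda>xs. xs ! 1 + Suc (xs ! 0)"])
      (intro recursive_on_add recursive_on_Suc recursive_on_nth; simp)
  moreover have "rec_nat 0 (\<lambda>k r. r + Suc k) a = triangle a" for a
    by (induction a) auto
  ultimately have "recursive_on 1 (\<lambda>xs. triangle (hd xs))"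
    by simp
  from recursive_on_comp1[OF this assms] show ?thesis by simp
qed

lemma recursive_on_prod_encode:
  assumes "recursive_on n f" "recursive_on n g"
  shows "recursive_on n (\<lambda>xs. prod_encode (f xs, g xs))"
  unfolding prod_encode_def by (simp add: assms recursive_on_add recursive_on_triangle)

text \<open>
  The pair coded by \<open>p\<close> lies on the diagonal with the largest triangular number not exceeding \<open>p\<close>, so the
  diagonal is found by minimization, and both components are then given by subtractions.
\<close>

lemma sum_of_prod_decode:
  "fst (prod_decode p) + snd (prod_decode p) = (LEAST s. Suc p - triangle (Suc s) = 0)"
proof -
  obtain a b where ab: "prod_decode p = (a, b)" by force
  then have p: "p = triangle (a + b) + a"
    using prod_decode_inverse[of p] by (simp add: prod_encode_def)
  have mono: "triangle (Suc s) \<le> triangle t" if "Suc s \<le> t" for s t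
    using that by (induction t rule: dec_induct) auto
  have "(LEAST s. Suc p - triangle (Suc s) = 0) = a + b"
  proof (rule Least_equality)
    show "Suc p - triangle (Suc (a + b)) = 0" by (simp add: p)
    show "a + b \<le> s" if "Suc p - triangle (Suc s) = 0" for s
      using that mono[of s "a + b"] p by (cases "a + b \<le> s") auto
  qed
  with ab show ?thesis by simp
qed

lemma recursive_on_prod_decode:
  assumes "recursive_on n f"
  shows recursive_on_fst_prod_decode: "recursive_on n (\<lambda>xs. fst (prod_decode (f xs)))"
    and recursive_on_snd_prod_decode: "recursive_on n (\<lambda>xs. snd (prod_decode (f xs)))"
proof -
  let ?s = "\<lambda>p. LEAST s. Suc p - triangle (Suc s) = 0"
  have "recursive_on 1 (\<lambda>xs. LEAST s. Suc ((s # xs) ! 1) - triangle (Suc ((s # xs) ! 0)) = 0)"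
  proof (rule recursive_on_Least[of 1 "\<lambda>ys. Suc (ys ! 1) - triangle (Suc (ys ! 0))"])
    show "recursive_on (Suc 1) (\<lambda>ys. Suc (ys ! 1) - triangle (Suc (ys ! 0)))"
      by (intro recursive_on_diff recursive_on_triangle recursive_on_Suc recursive_on_nth) auto
    show "\<exists>s. Suc ((s # xs) ! 1) - triangle (Suc ((s # xs) ! 0)) = 0" for xs :: "nat list"
      by (rule exI[of _ "xs ! 0"]) simp
  qed
  from recursive_on_comp1[OF this assms] have s: "recursive_on n (\<lambda>xs. ?s (f xs))"
    by simp
  have fst: "fst (prod_decode p) = p - triangle (?s p)"
    and snd: "snd (prod_decode p) = ?s p - (p - triangle (?s p))" for p
  proof -
    obtain a b where ab: "prod_decode p = (a, b)" by force
    then have p: "p = triangle (a + b) + a"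
      using prod_decode_inverse[of p] by (simp add: prod_encode_def)
    have "?s p = a + b" using sum_of_prod_decode[of p] ab by simp
    then show "fst (prod_decode p) = p - triangle (?s p)"
      "snd (prod_decode p) = ?s p - (p - triangle (?s p))"
      using ab p by auto
  qed
  show "recursive_on n (\<lambda>xs. fst (prod_decode (f xs)))" "recursive_on n (\<lambda>xs. snd (prod_decode (f xs)))"
    unfolding fst snd by (intro recursive_on_diff recursive_on_triangle assms s)+
qed


section \<open>Computable functions between coded types\<close>

text \<open>
  Codings are required to be bijective, so that every number codes an argument. A function then
  corresponds to exactly one function on numbers, and a search that succeeds for all arguments is a
  minimization that succeeds for all numbers, as \<open>recursive_fn\<close> demands.
\<close>

class coded =
  fixes code :: "'a \<Rightarrow> nat"
  assumes bij_code: "bij code"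
begin

definition decode :: "nat \<Rightarrow> 'a" where
  "decode = inv_into UNIV code"

lemma decode_code [simp]: "decode (code x) = x"
  unfolding decode_def by (simp add: bij_code bij_is_inj)

lemma code_decode [simp]: "code (decode n) = n"
  unfolding decode_def by (simp add: bij_code bij_is_surj surj_f_inv_f)

lemma code_eq_iff [simp]: "code x = code y \<longleftrightarrow> x = y"
  by (metis decode_code)

end

instantiation nat :: coded
begin
definition code_nat :: "nat \<Rightarrow> nat" where [simp]: "code_nat n = n"
instance by standard (simp add: bij_def inj_on_def surj_def)
end

instantiation prod :: (coded, coded) coded
begin
definition code_prod :: "'a \<times> 'b \<Rightarrow> nat" where
  "code_prod p = prod_encode (code (fst p), code (snd p))"
instance
proof
  have "bij (map_prod code code :: 'a \<times> 'b \<Rightarrow> nat \<times> nat)"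
    using bij_betw_map_prod[OF bij_code bij_code] by (simp only: UNIV_Times_UNIV)
  from bij_comp[OF this bij_prod_encode] show "bij (code :: 'a \<times> 'b \<Rightarrow> nat)"
    by (rule back_subst[of bij]) (auto simp: code_prod_def map_prod_def)
qed
end

instantiation list :: (coded) coded
begin
definition code_list :: "'a list \<Rightarrow> nat" where
  "code_list xs = list_encode (map code xs)"
instance
proof
  have "bij (map code :: 'a list \<Rightarrow> nat list)"
    by (rule o_bij[where g = "map decode"]) (simp_all add: fun_eq_iff comp_def)
  from bij_comp[OF this bij_list_encode] show "bij (code :: 'a list \<Rightarrow> nat)"
    by (rule back_subst[of bij]) (auto simp: code_list_def)
qed
end

definition computable :: "('a::coded \<Rightarrow> 'b::coded) \<Rightarrow> bool" where
  "computable f \<longleftrightarrow> recursive_on 1 (\<lambda>xs. code (f (decode (xs ! 0))))"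

text \<open>
  The closure properties below are stated for functions of a common argument \<open>x\<close>. A function with
  further bound variables, such as the body of an iteration, appears as a function of a tuple that contains
  \<open>x\<close> and these variables. Computability of a composite function is then proved by applying the rules
  along its syntax.
\<close>

named_theorems computable_intros

lemma computableI:
  assumes "recursive_on 1 (\<lambda>xs. h (xs ! 0))" "\<And>x. code (f x) = h (code x)"
  shows "computable f"
  unfolding computable_def using assms(1)
  by (rule recursive_on_cong) (simp add: assms(2))

lemma computable_comp:
  assumes "computable f" "computable g"
  shows "computable (\<lambda>x. f (g x))"
  unfolding computable_def
  using recursive_on_comp1[OF assms[unfolded computable_def]] by simp

lemma computable_ident [computable_intros]: "computable (\<lambda>x. x)"
  by (rule computableI[where h = "\<lambda>n. n"]) (simp_all add: recursive_on_nth)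

lemma computable_const [computable_intros]: "computable (\<lambda>x. c)"
  by (rule computableI[where h = "\<lambda>n. code c"]) (simp_all add: recursive_on_const)

lemma computable_Pair [computable_intros]:
  assumes "computable f" "computable g"
  shows "computable (\<lambda>x. (f x, g x))"
  using assms unfolding computable_def by (simp add: code_prod_def recursive_on_prod_encode)

lemma computable_fst [computable_intros]:
  assumes "computable f"
  shows "computable (\<lambda>x. fst (f x))"
proof (rule computable_comp[OF _ assms])
  show "computable (fst :: 'b \<times> 'c \<Rightarrow> 'b)"
    by (rule computableI[where h = "\<lambda>n. fst (prod_decode n)"])
      (simp_all add: code_prod_def recursive_on_fst_prod_decode recursive_on_nth)
qed

lemma computable_snd [computable_intros]:
  assumes "computable f"
  shows "computable (\<lambda>x. snd (f x))"
proof (rule computable_comp[OF _ assms])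
  show "computable (snd :: 'b \<times> 'c \<Rightarrow> 'c)"
    by (rule computableI[where h = "\<lambda>n. snd (prod_decode n)"])
      (simp_all add: code_prod_def recursive_on_snd_prod_decode recursive_on_nth)
qed

lemma computable_code [computable_intros]: "computable f \<Longrightarrow> computable (\<lambda>x. code (f x))"
  unfolding computable_def by simp

lemma computable_decode [computable_intros]: "computable f \<Longrightarrow> computable (\<lambda>x. decode (f x))"
  unfolding computable_def by simp

lemma computable_arith [computable_intros]:
  fixes f g :: "'a::coded \<Rightarrow> nat"
  assumes "computable f" "computable g"
  shows computable_add: "computable (\<lambda>x. f x + g x)"
    and computable_diff: "computable (\<lambda>x. f x - g x)"
    and computable_mult: "computable (\<lambda>x. f x * g x)"
  using assms unfolding computable_def
  by (simp_all add: recursive_on_add recursive_on_diff recursive_on_mult)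

lemma computable_Suc [computable_intros]: "computable f \<Longrightarrow> computable (\<lambda>x. Suc (f x))"
  unfolding computable_def by (simp add: recursive_on_Suc)

text \<open>
  Iteration is primitive recursion with the code of \<open>x\<close> as parameter and the code of the current state as
  the value of the recursion.
\<close>

lemma computable_funpow [computable_intros]:
  fixes f :: "'a::coded \<Rightarrow> 'b::coded \<Rightarrow> 'b"
  assumes "computable (\<lambda>z. f (fst z) (snd z))" "computable c" "computable a"
  shows "computable (\<lambda>x. (f x ^^ c x) (a x))"
proof -
  let ?F = "\<lambda>m. code (case decode m :: 'a \<times> 'b of (x, y) \<Rightarrow> f x y)"
  let ?h = "\<lambda>k n. rec_nat (code (a (decode n))) (\<lambda>k r. ?F (prod_encode (n, r))) k"
  have F: "recursive_on 1 (\<lambda>xs. ?F (xs ! 0))"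
    using assms(1) unfolding computable_def by (simp add: case_prod_beta)
  have "recursive_on 2 (\<lambda>xs. rec_nat ((\<lambda>xs. code (a (decode (xs ! 0)))) [xs ! 1])
      (\<lambda>k r. (\<lambda>xs. ?F (prod_encode (xs ! 2, xs ! 1))) [k, r, xs ! 1]) (xs ! 0))"
  proof (rule recursive_on_binary_rec)
    show "recursive_on 1 (\<lambda>xs. code (a (decode (xs ! 0))))"
      using assms(3) unfolding computable_def .
    have "recursive_on 3 (\<lambda>xs. prod_encode (xs ! 2, xs ! 1))"
      by (intro recursive_on_prod_encode recursive_on_nth) simp_all
    from recursive_on_comp1[OF F this]
    show "recursive_on 3 (\<lambda>xs. ?F (prod_encode (xs ! 2, xs ! 1)))" by simp
  qed
  then have "recursive_on 2 (\<lambda>xs. ?h (xs ! 0) (xs ! 1))"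
    by simp
  from recursive_on_comp2[OF this assms(2)[unfolded computable_def] recursive_on_nth[of 0 1]]
  have "recursive_on 1 (\<lambda>xs. ?h (c (decode (xs ! 0))) (xs ! 0))"
    by simp
  then show ?thesis
  proof (rule computableI[where h = "\<lambda>n. ?h (c (decode n)) n"])
    fix x
    have "code ((f x ^^ k) (a x)) = ?h k (code x)" for k
    proof (induction k)
      case (Suc k)
      have "prod_encode (code x, ?h k (code x)) = code (x, (f x ^^ k) (a x))"
        using Suc by (simp add: code_prod_def)
      then show ?case by simp
    qed simp
    then show "code ((f x ^^ c x) (a x)) = ?h (c (decode (code x))) (code x)"
      by simp
  qed
qed


subsection \<open>Decidable predicates, branching and search\<close>

definition decidable :: "('a::coded \<Rightarrow> bool) \<Rightarrow> bool" where
  "decidable P \<longleftrightarrow> computable (\<lambda>x. of_bool (P x) :: nat)"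

lemma computable_if [computable_intros]:
  assumes "decidable P" "computable f" "computable g"
  shows "computable (\<lambda>x. if P x then f x else g x)"
proof -
  have "computable (\<lambda>x. decode (of_bool (P x) * code (f x) + (1 - of_bool (P x)) * code (g x)))"
    using assms unfolding decidable_def by (intro computable_intros)
  then show ?thesis
    by (rule back_subst[of computable]) auto
qed

lemma decidable_eq [computable_intros]:
  assumes "computable f" "computable g"
  shows "decidable (\<lambda>x. f x = g x)"
proof -
  have "computable (\<lambda>x. 1 - ((code (f x) - code (g x)) + (code (g x) - code (f x))))"
    using assms by (intro computable_intros)
  moreover have "1 - ((m - n) + (n - m)) = of_bool (m = n)" for m n :: nat
    by auto
  ultimately show ?thesis
    unfolding decidable_def by simp
qed

lemma decidable_conj [computable_intros]:
  assumes "decidable P" "decidable Q"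
  shows "decidable (\<lambda>x. P x \<and> Q x)"
  using computable_mult[OF assms[unfolded decidable_def]]
  unfolding decidable_def by (rule back_subst[of computable]) auto

lemma decidable_less [computable_intros]:
  fixes f g :: "'a::coded \<Rightarrow> nat"
  assumes "computable f" "computable g"
  shows "decidable (\<lambda>x. f x < g x)"
proof -
  have "computable (\<lambda>x. 1 - (Suc (f x) - g x))"
    using assms by (intro computable_intros)
  then show ?thesis
    unfolding decidable_def by (rule back_subst[of computable]) auto
qed

lemma decidable_comp:
  assumes "decidable P" "computable f"
  shows "decidable (\<lambda>x. P (f x))"
  using computable_comp[OF assms(1)[unfolded decidable_def] assms(2)] unfolding decidable_def .

text \<open>
  Unbounded search: the codes of candidates \<open>y\<close> are tried in increasing order. This is the only use of
  minimization besides the decoding of pairs.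
\<close>

lemma computable_choice:
  fixes P :: "'a::coded \<Rightarrow> 'b::coded \<Rightarrow> bool"
  assumes "decidable (\<lambda>z. P (fst z) (snd z))" "\<And>x. \<exists>y. P x y"
  obtains f where "computable f" "\<And>x. P x (f x)"
proof -
  let ?q = "\<lambda>y n. of_bool (\<not> P (decode n) (decode y)) :: nat"
  have "computable (\<lambda>z. 1 - of_bool (P (fst z) (snd z)) :: nat)"
    using assms(1) unfolding decidable_def by (intro computable_intros)
  then have "recursive_on 1 (\<lambda>xs. of_bool (\<not> (case decode (xs ! 0) of (x, y) \<Rightarrow> P x y)))"
    unfolding computable_def by (rule recursive_on_cong) (auto simp: case_prod_beta)
  from recursive_on_comp1[OF this recursive_on_prod_encode[OF recursive_on_nth[of 1 2] recursive_on_nth[of 0 2]]]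
  have "recursive_on 2 (\<lambda>ys. of_bool (\<not> (case decode (prod_encode (ys ! 1, ys ! 0)) of (x, y) \<Rightarrow> P x y)))"
    by simp
  moreover have "decode (prod_encode (m, n)) = (decode m :: 'a, decode n :: 'b)" for m n
    by (metis code_decode code_prod_def decode_code fst_conv snd_conv)
  ultimately have "recursive_on (Suc 1) (\<lambda>ys. ?q (ys ! 0) (ys ! 1))"
    by (simp add: numeral_2_eq_2)
  from recursive_on_Least[OF this]
  have "recursive_on 1 (\<lambda>xs. LEAST y. ?q y (xs ! 0) = 0)"
    using assms(2) by simp (metis decode_code)
  then have "computable (\<lambda>x. decode (LEAST y. ?q y (code x) = 0) :: 'b)"
    by (rule computableI) simp
  moreover have "P x (decode (LEAST y. ?q y (code x) = 0))" for x
  proof -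
    obtain y where "P x y" using assms(2) by blast
    then have "?q (code y) (code x) = 0" by simp
    then have "?q (LEAST y. ?q y (code x) = 0) (code x) = 0" by (rule LeastI)
    then show ?thesis by simp
  qed
  ultimately show thesis by (rule that)
qed


subsection \<open>Lists\<close>

lemma code_Nil: "code [] = 0"
  by (simp add: code_list_def)

lemma code_Cons: "code (x # xs) = Suc (code (x, xs))"
  by (simp add: code_list_def code_prod_def)

lemma computable_Cons [computable_intros]:
  assumes "computable f" "computable g"
  shows "computable (\<lambda>x. f x # g x)"
proof -
  have "computable (\<lambda>x. decode (Suc (code (f x, g x))) :: 'b list)"
    using assms by (intro computable_intros)
  then show ?thesis by (simp flip: code_Cons)
qed

lemma computable_case_list [computable_intros]:
  assumes "computable l" "computable a" "computable (\<lambda>z. f (fst z) (fst (snd z)) (snd (snd z)))"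
  shows "computable (\<lambda>x. case l x of [] \<Rightarrow> a x | y # ys \<Rightarrow> f x y ys)"
proof -
  have "computable (\<lambda>x. (x, decode (code (l x) - 1) :: 'b \<times> 'b list))"
    using assms by (intro computable_intros)
  from computable_comp[OF assms(3) this]
  have "computable (\<lambda>x. if code (l x) = 0 then a x else
      f x (fst (decode (code (l x) - 1) :: 'b \<times> 'b list)) (snd (decode (code (l x) - 1) :: 'b \<times> 'b list)))"
    using assms by (intro computable_intros) simp_all
  then show ?thesis
    by (rule back_subst[of computable]) (auto simp: fun_eq_iff code_Nil code_Cons split: list.split)
qed

lemma length_le_code: "length xs \<le> code xs"
proof (induction xs)
  case (Cons x xs)
  also have "code xs \<le> code (x, xs)"
    by (simp add: code_prod_def le_prod_encode_2)
  finally show ?case by (simp add: code_Cons)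
qed simp

text \<open>
  A fold is an iteration on pairs of an accumulator and the remaining list. The code of the list bounds its
  length and can therefore serve as the number of iterations: further steps change nothing once the
  list is exhausted.
\<close>

lemma computable_foldl [computable_intros]:
  assumes "computable (\<lambda>z. f (fst z) (fst (snd z)) (snd (snd z)))" "computable a" "computable l"
  shows "computable (\<lambda>x. foldl (f x) (a x) (l x))"
proof -
  let ?step = "\<lambda>x s. case snd s of [] \<Rightarrow> s | y # ys \<Rightarrow> (f x (fst s) y, ys)"
  have iter: "length ys \<le> n \<Longrightarrow> (?step x ^^ n) (b, ys) = (foldl (f x) b ys, [])" for x b ys n
  proof (induction n arbitrary: b ys)
    case (Suc n)
    then show ?case
      by (cases ys) (simp_all add: funpow_Suc_right del: funpow.simps)
  qed simp
  have "computable (\<lambda>z. (fst (fst z), (fst (snd (fst z)), fst (snd z))))"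
    by (intro computable_intros)
  note f = computable_comp[OF assms(1) this, simplified]
  have "computable (\<lambda>x. fst ((?step x ^^ code (l x)) (a x, l x)))"
    by (intro computable_intros assms f)
  then show ?thesis
    by (simp add: iter length_le_code)
qed

lemma computable_rev [computable_intros]:
  assumes "computable l"
  shows "computable (\<lambda>x. rev (l x))"
proof -
  have "foldl (\<lambda>a y. y # a) b xs = rev xs @ b" for b xs :: "'b list"
    by (induction xs arbitrary: b) auto
  moreover have "computable (\<lambda>x. foldl (\<lambda>a y. y # a) [] (l x))"
    by (intro computable_intros assms)
  ultimately show ?thesis by simp
qed

lemma computable_append [computable_intros]:
  assumes "computable l" "computable l'"
  shows "computable (\<lambda>x. l x @ l' x)"
proof -
  have "foldl (\<lambda>a y. y # a) b xs = rev xs @ b" for b xs :: "'b list"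
    by (induction xs arbitrary: b) auto
  moreover have "computable (\<lambda>x. foldl (\<lambda>a y. y # a) (l' x) (rev (l x)))"
    by (intro computable_intros assms)
  ultimately show ?thesis by simp
qed

lemma computable_concat_map [computable_intros]:
  assumes "computable (\<lambda>z. f (fst z) (snd z))" "computable l"
  shows "computable (\<lambda>x. concat (map (f x) (l x)))"
proof -
  have "foldl (\<lambda>a y. a @ g y) b ys = b @ concat (map g ys)" for g :: "'b \<Rightarrow> 'c list" and b ys
    by (induction ys arbitrary: b) auto
  moreover
  have "computable (\<lambda>z. (fst z :: 'a, snd (snd z :: 'c list \<times> 'b)))"
    by (intro computable_intros)
  note computable_comp[OF assms(1) this, simplified]
  then have "computable (\<lambda>x. foldl (\<lambda>a y. a @ f x y) [] (l x))"
    by (intro computable_intros assms)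
  ultimately show ?thesis by simp
qed

text \<open>
  The list is split at position \<open>i x\<close> by moving its first elements, one at a time, onto an initially empty
  stack.
\<close>

lemma computable_insert_at [computable_intros]:
  assumes "computable i" "computable r" "computable l"
  shows "computable (\<lambda>x. take (i x) (l x) @ r x @ drop (i x) (l x))"
proof -
  let ?step = "\<lambda>s. case snd s of [] \<Rightarrow> s | y # ys \<Rightarrow> (y # fst s, ys)"
  have iter: "(?step ^^ n) (a, b) = (rev (take n b) @ a, drop n b)" for n and a b :: "'b list"
  proof (induction n arbitrary: a b)
    case (Suc n)
    then show ?case
      by (cases b) (simp_all add: funpow_Suc_right del: funpow.simps)
  qed simp
  have "computable (\<lambda>x. (?step ^^ i x) ([], l x))"
    by (intro computable_intros assms)
  then have "computable (\<lambda>x. rev (fst ((?step ^^ i x) ([], l x))) @ r x @ snd ((?step ^^ i x) ([], l x)))"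
    by (intro computable_intros assms)
  then show ?thesis by (simp add: iter)
qed

text \<open>
  A word over the first \<open>n\<close> letters is one that is unchanged when all other letters are deleted.
\<close>

lemma decidable_set_subset_lessThan: "decidable (\<lambda>w. set w \<subseteq> {..<n::nat})"
proof -
  have "decidable (\<lambda>w. concat (map (\<lambda>k. if k < n then [k] else []) w) = w)"
    by (intro computable_intros)
  moreover have "concat (map (\<lambda>k. if k < n then [k] else []) w) = filter (\<lambda>k. k < n) w" for w
    by (induction w) auto
  ultimately show ?thesis
    by (simp add: filter_id_conv subset_eq)
qed

lemma computable_finite_table:
  assumes "\<And>k. n \<le> k \<Longrightarrow> f k = c"
  shows "computable (f :: nat \<Rightarrow> 'a::coded)"
proof -
  have "computable (\<lambda>k. if k < m then f k else c)" for m
  proof (induction m)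
    case (Suc m)
    have "computable (\<lambda>k. if k = m then f m else if k < m then f k else c)"
      by (intro computable_intros Suc)
    then show ?case
      by (rule back_subst[of computable]) (auto simp: fun_eq_iff)
  qed (simp add: computable_const)
  from this[of n] show ?thesis
    by (rule back_subst[of computable]) (auto simp: fun_eq_iff assms)
qed


subsection \<open>Recursive and recursively enumerable sets\<close>

lemma recursive_set_image_code_iff: "recursive_set (code ` A) \<longleftrightarrow> decidable (\<lambda>x. x \<in> A)"
proof -
  have "recursive_set B \<longleftrightarrow> recursive_on 1 (\<lambda>xs. of_bool (xs ! 0 \<in> B))" for B
    unfolding recursive_set_def recursive_on_def
    by (auto simp: of_bool_def length_Suc_conv)
  moreover have "n \<in> code ` A \<longleftrightarrow> decode n \<in> A" for n
    by (metis code_decode decode_code imageE imageI)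
  ultimately show ?thesis
    unfolding decidable_def computable_def by simp
qed

text \<open>
  The notion \<open>re_set\<close> for subsets of coded types; it provides enumerations whose values are
  elements rather than their codes.
\<close>

definition enumerable :: "'a::coded set \<Rightarrow> bool" where
  "enumerable A \<longleftrightarrow> A = {} \<or> (\<exists>f :: nat \<Rightarrow> 'a. computable f \<and> A = range f)"

lemma re_set_image_code_imp_enumerable:
  assumes "re_set (code ` A)"
  shows "enumerable A"
proof (cases "A = {}")
  case False
  with assms obtain f where f: "recursive_fn 1 f" "code ` A = range (\<lambda>n. f [n])"
    unfolding re_set_def by auto
  have "recursive_on 1 (\<lambda>xs. f [xs ! 0])"
    using recursive_onI[OF f(1)] by (rule recursive_on_cong) (auto simp: length_Suc_conv)
  then have "computable (\<lambda>n. f [n])"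
    by (rule computableI[where h = "\<lambda>n. f [n]"]) simp
  then have "computable (\<lambda>n. decode (f [n]) :: 'a)"
    by (intro computable_intros)
  moreover have "A = decode ` code ` A"
    by (simp add: image_image)
  then have "A = range (\<lambda>n. decode (f [n]))"
    by (simp add: f(2) image_image)
  ultimately show ?thesis
    unfolding enumerable_def by blast
qed (simp add: enumerable_def)

lemma enumerable_image:
  assumes "enumerable A" "computable g"
  shows "enumerable (g ` A)"
proof (cases "A = {}")
  case False
  with assms obtain f :: "nat \<Rightarrow> 'a" where f: "computable f" "A = range f"
    unfolding enumerable_def by auto
  then have "g ` A = range (\<lambda>n. g (f n))" by (simp add: image_image)
  with computable_comp[OF assms(2) f(1)] show ?thesis
    unfolding enumerable_def by blast
qed (simp add: enumerable_def)

lemma enumerable_Un: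
  assumes "enumerable A" "enumerable B"
  shows "enumerable (A \<union> B)"
proof (cases "A = {} \<or> B = {}")
  case True
  with assms show ?thesis by auto
next
  case False
  with assms obtain f g :: "nat \<Rightarrow> 'a" where f: "computable f" "A = range f" and g: "computable g" "B = range g"
    unfolding enumerable_def by auto
  let ?h = "\<lambda>z :: nat \<times> nat. if fst z = 0 then f (snd z) else g (snd z)"
  have "computable (\<lambda>n. ?h (decode n))"
    by (intro computable_intros computable_comp[OF f(1)] computable_comp[OF g(1)])
  moreover have "range (\<lambda>n. ?h (decode n)) = A \<union> B"
  proof
    show "range (\<lambda>n. ?h (decode n)) \<subseteq> A \<union> B"
      unfolding f g by auto
    show "A \<union> B \<subseteq> range (\<lambda>n. ?h (decode n))"
    proof
      fix x assume "x \<in> A \<union> B"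
      then obtain n :: nat where "x = ?h (decode (code (0 :: nat, n))) \<or> x = ?h (decode (code (1 :: nat, n)))"
        unfolding f g decode_code by auto
      then show "x \<in> range (\<lambda>n. ?h (decode n))" by blast
    qed
  qed
  ultimately show ?thesis
    unfolding enumerable_def by blast
qed

lemma enumerable_singleton: "enumerable {x}"
  unfolding enumerable_def using computable_const by fastforce


section \<open>Equality of words in a presented group\<close>

subsection \<open>The free group\<close>

text \<open>
  Words over \<open>S \<times> UNIV\<close> are treated as wholes: membership in \<open>lists\<close> is only split along
  list constructors and concatenation, not into membership of the single letters.
\<close>

declare in_lists_conv_set [simp del] in_listsI [rule del] in_listsD [rule del]

lemma free_equiv_subset: "free_equiv S \<subseteq> lists (S \<times> UNIV) \<times> lists (S \<times> UNIV)"
proof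
  fix p assume "p \<in> free_equiv S"
  then show "p \<in> lists (S \<times> UNIV) \<times> lists (S \<times> UNIV)"
  proof (induction p)
    case (Pair v w)
    then show ?case by (induction rule: free_equiv.induct) auto
  qed
qed

lemma equiv_free_equiv: "equiv (lists (S \<times> UNIV)) (free_equiv S)"
  by (intro equivI refl_onI symI transI free_equiv_subset)
    (auto intro: free_equiv.intros)

lemma free_equiv_append_context:
  assumes "(v, w) \<in> free_equiv S" "x \<in> lists (S \<times> UNIV)" "y \<in> lists (S \<times> UNIV)"
  shows "(x @ v @ y, x @ w @ y) \<in> free_equiv S"
  using assms(1)
proof induction
  case (refl w)
  with assms(2,3) show ?case by (intro free_equiv.refl) auto
next
  case (cancel u v s b)
  from free_equiv.cancel[of "x @ u" S "v @ y" s b] cancel assms(2,3) show ?case by simp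
qed (blast intro: free_equiv.intros)+

lemma free_equiv_append:
  assumes "(u, u') \<in> free_equiv S" "(v, v') \<in> free_equiv S"
  shows "(u @ v, u' @ v') \<in> free_equiv S"
proof -
  have "v \<in> lists (S \<times> UNIV)" "u' \<in> lists (S \<times> UNIV)"
    using assms free_equiv_subset by blast+
  with free_equiv_append_context[OF assms(1), of "[]" v] free_equiv_append_context[OF assms(2), of u' "[]"]
  have "(u @ v, u' @ v) \<in> free_equiv S" "(u' @ v, u' @ v') \<in> free_equiv S"
    by auto
  then show ?thesis by (rule free_equiv.trans)
qed

definition word_class :: "'s set \<Rightarrow> ('s \<times> bool) list \<Rightarrow> ('s \<times> bool) list set" where
  "word_class S w = free_equiv S `` {w}"

lemma word_class_eq_iff:
  assumes "v \<in> lists (S \<times> UNIV)" "w \<in> lists (S \<times> UNIV)"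
  shows "word_class S v = word_class S w \<longleftrightarrow> (v, w) \<in> free_equiv S"
  unfolding word_class_def using eq_equiv_class_iff[OF equiv_free_equiv] assms by blast

lemma carrier_free_group: "carrier (free_group S) = word_class S ` lists (S \<times> UNIV)"
  by (auto simp: free_group_def word_class_def quotient_def)

lemma one_free_group: "\<one>\<^bsub>free_group S\<^esub> = word_class S []"
  by (simp add: free_group_def word_class_def)

lemma mult_free_group:
  assumes "v \<in> lists (S \<times> UNIV)" "w \<in> lists (S \<times> UNIV)"
  shows "word_class S v \<otimes>\<^bsub>free_group S\<^esub> word_class S w = word_class S (v @ w)"
proof -
  have "free_equiv S `` {x @ y |x y. (v, x) \<in> free_equiv S \<and> (w, y) \<in> free_equiv S} = free_equiv S `` {v @ w}"
    (is "?L = ?R")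
  proof
    show "?L \<subseteq> ?R"
    proof
      fix z assume "z \<in> ?L"
      then obtain x y where "(v, x) \<in> free_equiv S" "(w, y) \<in> free_equiv S" "(x @ y, z) \<in> free_equiv S"
        by blast
      then show "z \<in> ?R"
        using free_equiv.trans[OF free_equiv_append] by blast
    qed
    show "?R \<subseteq> ?L"
    proof
      fix z assume "z \<in> ?R"
      moreover have "v @ w \<in> {x @ y |x y. (v, x) \<in> free_equiv S \<and> (w, y) \<in> free_equiv S}"
        using assms by (blast intro: free_equiv.refl)
      ultimately show "z \<in> ?L" by (blast intro: ImageI)
    qed
  qed
  then show ?thesis by (simp add: free_group_def word_class_def)
qed

definition inverse_word :: "('s \<times> bool) list \<Rightarrow> ('s \<times> bool) list" where
  "inverse_word w = rev (map (\<lambda>(s, b). (s, \<not> b)) w)"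

lemma inverse_word_in_lists: "w \<in> lists (S \<times> UNIV) \<Longrightarrow> inverse_word w \<in> lists (S \<times> UNIV)"
  by (auto simp: inverse_word_def in_lists_conv_set)

lemma inverse_word_cancel:
  assumes "w \<in> lists (S \<times> UNIV)"
  shows "(inverse_word w @ w, []) \<in> free_equiv S"
  using assms
proof (induction w)
  case Nil
  show ?case by (simp add: inverse_word_def free_equiv.refl)
next
  case (Cons l w)
  obtain s b where l: "l = (s, b)" by force
  with Cons have "s \<in> S" "w \<in> lists (S \<times> UNIV)" by auto
  with free_equiv.cancel[of "inverse_word w" S w s "\<not> b"] inverse_word_in_lists[of w S]
  have "(inverse_word (l # w) @ l # w, inverse_word w @ w) \<in> free_equiv S"
    by (simp add: inverse_word_def l)
  then show ?case
    using Cons by (blast intro: free_equiv.trans)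
qed

lemma group_free_group: "group (free_group S)"
proof (rule groupI)
  show "\<one>\<^bsub>free_group S\<^esub> \<in> carrier (free_group S)"
    unfolding carrier_free_group one_free_group by (rule imageI) simp
next
  fix x assume "x \<in> carrier (free_group S)"
  then obtain u where u: "u \<in> lists (S \<times> UNIV)" "x = word_class S u"
    unfolding carrier_free_group by blast
  then show "\<one>\<^bsub>free_group S\<^esub> \<otimes>\<^bsub>free_group S\<^esub> x = x"
    by (simp add: mult_free_group one_free_group)
  have "word_class S (inverse_word u) \<otimes>\<^bsub>free_group S\<^esub> x = \<one>\<^bsub>free_group S\<^esub>"
    using inverse_word_cancel[OF u(1)] u inverse_word_in_lists[OF u(1)]
    by (simp add: mult_free_group one_free_group word_class_eq_iff)
  then show "\<exists>y\<in>carrier (free_group S). y \<otimes>\<^bsub>free_group S\<^esub> x = \<one>\<^bsub>free_group S\<^esub>"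
    using inverse_word_in_lists[OF u(1)] unfolding carrier_free_group by blast
  fix y assume "y \<in> carrier (free_group S)"
  then obtain v where v: "v \<in> lists (S \<times> UNIV)" "y = word_class S v"
    unfolding carrier_free_group by blast
  with u show "x \<otimes>\<^bsub>free_group S\<^esub> y \<in> carrier (free_group S)"
    by (simp add: mult_free_group carrier_free_group)
  fix z assume "z \<in> carrier (free_group S)"
  then obtain w where "w \<in> lists (S \<times> UNIV)" "z = word_class S w"
    unfolding carrier_free_group by blast
  with u v show "x \<otimes>\<^bsub>free_group S\<^esub> y \<otimes>\<^bsub>free_group S\<^esub> z =
      x \<otimes>\<^bsub>free_group S\<^esub> (y \<otimes>\<^bsub>free_group S\<^esub> z)"
    by (simp add: mult_free_group)
qed

lemma inv_free_group:
  assumes "w \<in> lists (S \<times> UNIV)"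
  shows "inv\<^bsub>free_group S\<^esub> word_class S w = word_class S (inverse_word w)"
  using assms inverse_word_in_lists[OF assms] inverse_word_cancel[OF assms]
  by (intro group.inv_equality[OF group_free_group])
    (auto simp: carrier_free_group mult_free_group one_free_group word_class_eq_iff)

lemma normal_normal_closure:
  assumes "group G" "R \<subseteq> carrier G"
  shows "normal_closure G R \<lhd> G"
proof -
  interpret group G by fact
  have "carrier G \<lhd> G"
    by (intro normal_invI subgroup_self) auto
  then have "subgroup (normal_closure G R) G"
    unfolding normal_closure_def using assms(2)
    by (intro subgroups_Inter) (auto intro: normal_imp_subgroup)
  then show ?thesis
    by (rule normal_invI) (auto simp: normal_closure_def intro: normal.inv_op_closed2)
qed


subsection \<open>Insertion of relators\<close>

definition insertion :: "'l list set \<Rightarrow> 'l list \<Rightarrow> 'l list \<Rightarrow> bool" where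
  "insertion V v w \<longleftrightarrow> (\<exists>x y r. r \<in> V \<and> v = x @ y \<and> w = x @ r @ y)"

text \<open>
  Insertions at two places of the same word do not interfere. At a common place one order
  of the two relators is chosen; the relator that is still missing is then inserted before or after the
  other one.
\<close>

lemma strong_confluentp_insertion: "strong_confluentp (insertion V)"
proof
  have joinable: "\<exists>u. insertion V (x @ r @ p @ y) u \<and> insertion V (x @ p @ s @ y) u"
    if "r \<in> V" "s \<in> V" for x p y r s
    using that
  proof (intro exI conjI)
    show "insertion V (x @ r @ p @ y) (x @ r @ p @ s @ y)"
      unfolding insertion_def using that(2)
      by (intro exI[of _ "x @ r @ p"] exI[of _ y] exI[of _ s]) simp
    show "insertion V (x @ p @ s @ y) (x @ r @ p @ s @ y)"
      unfolding insertion_def using that(1)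
      by (intro exI[of _ x] exI[of _ "p @ s @ y"] exI[of _ r]) simp
  qed
  fix u v w assume "insertion V u v" "insertion V u w"
  then obtain x y r x' y' s where v: "u = x @ y" "v = x @ r @ y" "r \<in> V"
    and w: "u = x' @ y'" "w = x' @ s @ y'" "s \<in> V"
    unfolding insertion_def by blast
  from v(1) w(1) consider p where "x' = x @ p" "y = p @ y'" | p where "x = x' @ p" "y' = p @ y"
    using append_eq_append_conv2[of x y x' y'] by metis
  then have "\<exists>z. insertion V v z \<and> insertion V w z"
  proof cases
    case 1
    with joinable[OF v(3) w(3), of x p y'] v w show ?thesis by simp
  next
    case 2
    with joinable[OF w(3) v(3), of x' p y] v w show ?thesis by auto
  qed
  then show "\<exists>z. (insertion V)\<^sup>*\<^sup>* v z \<and> (insertion V)\<^sup>=\<^sup>= w z"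
    by blast
qed

text \<open>
  The Church-Rosser property: deletions can be avoided.
\<close>

lemma equivclp_insertion_iff:
  "equivclp (insertion V) v w \<longleftrightarrow> (\<exists>z. (insertion V)\<^sup>*\<^sup>* v z \<and> (insertion V)\<^sup>*\<^sup>* w z)"
  unfolding semiconfluentp_equivclp[OF strong_confluentp_into_semiconfluentp[OF strong_confluentp_insertion]]
  by (auto simp: rtranclp_conversep)

lemma equivclp_trans: "equivclp r x y \<Longrightarrow> equivclp r y z \<Longrightarrow> equivclp r x z"
  by (meson transpE transp_equivclp)

lemma equivclp_refl: "equivclp r x x"
  by (simp add: equivclp_def)

lemma insertion_append_context:
  assumes "insertion V v w"
  shows "insertion V (x @ v @ y) (x @ w @ y)"
proof -
  from assms obtain a b r where "r \<in> V" "v = a @ b" "w = a @ r @ b"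
    unfolding insertion_def by blast
  then show ?thesis
    unfolding insertion_def by (intro exI[of _ "x @ a"] exI[of _ "b @ y"] exI[of _ r]) simp
qed

lemma equivclp_insertion_append_context:
  "equivclp (insertion V) v w \<Longrightarrow> equivclp (insertion V) (x @ v @ y) (x @ w @ y)"
proof (induction rule: equivclp_induct)
  case (step u w)
  then have "equivclp (insertion V) (x @ u @ y) (x @ w @ y)"
    by (blast intro: insertion_append_context equivclp_sym r_into_equivclp)
  with step show ?case by (blast intro: equivclp_trans)
qed (rule equivclp_refl)

lemma equivclp_insertion_append:
  assumes "equivclp (insertion V) u u'" "equivclp (insertion V) v v'"
  shows "equivclp (insertion V) (u @ v) (u' @ v')"
  using equivclp_insertion_append_context[OF assms(1), of "[]" v]
    equivclp_insertion_append_context[OF assms(2), of u' "[]"]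
  by (auto intro: equivclp_trans)

lemma insertion_in_lists_iff:
  assumes "V \<subseteq> lists A" "insertion V v w"
  shows "v \<in> lists A \<longleftrightarrow> w \<in> lists A"
proof -
  from assms obtain x y r where "r \<in> lists A" "v = x @ y" "w = x @ r @ y"
    unfolding insertion_def by blast
  then show ?thesis by simp
qed

text \<open>
  Free cancellation becomes the deletion of a relator. The empty word is included so that there is always a
  relator, and the relators can be enumerated by a total function even if \<open>S\<close> and \<open>R\<close> are empty.
\<close>

definition relators :: "'s set \<Rightarrow> ('s \<times> bool) list set \<Rightarrow> ('s \<times> bool) list set" where
  "relators S R = insert [] R \<union> {[(s, b), (s, \<not> b)] |s b. s \<in> S}"

lemma free_equiv_imp_equivclp:
  assumes "(v, w) \<in> free_equiv S"
  shows "equivclp (insertion (relators S R)) v w"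
  using assms
proof induction
  case (cancel u v s b)
  then have "insertion (relators S R) (u @ v) (u @ [(s, b), (s, \<not> b)] @ v)"
    unfolding insertion_def relators_def by blast
  then show ?case by (meson equivclp_sym r_into_equivclp)
qed (blast intro: equivclp_refl equivclp_sym equivclp_trans)+

text \<open>
  The normal closure is bounded from above by a normal subgroup that contains \<open>R\<close>: words connected with the
  empty word stay so under concatenation, inversion and conjugation because
  insertions can be made inside any context.
\<close>

lemma normal_trivial_words:
  "word_class S ` {w \<in> lists (S \<times> UNIV). equivclp (insertion (relators S R)) w []} \<lhd> free_group S"
  (is "word_class S ` ?W \<lhd> ?F")
proof -
  let ?eq = "equivclp (insertion (relators S R))"
  interpret F: group ?F by (rule group_free_group)
  have inv: "?eq (inverse_word w) []" if "w \<in> ?W" for w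
  proof -
    have "?eq (inverse_word w @ w) (inverse_word w @ [])"
      using that by (intro equivclp_insertion_append equivclp_refl) auto
    moreover have "?eq (inverse_word w @ w) []"
      using that inverse_word_cancel free_equiv_imp_equivclp by blast
    ultimately show ?thesis
      by (metis append_Nil2 equivclp_sym equivclp_trans)
  qed
  show ?thesis
  proof (rule F.normal_invI)
    show "subgroup (word_class S ` ?W) ?F"
    proof (rule F.subgroupI)
      show "word_class S ` ?W \<subseteq> carrier ?F" by (auto simp: carrier_free_group)
      have "[] \<in> ?W" by (simp add: equivclp_refl)
      then show "word_class S ` ?W \<noteq> {}" by blast
      fix a assume "a \<in> word_class S ` ?W"
      then obtain v where v: "v \<in> ?W" "a = word_class S v" by blast
      then show "inv\<^bsub>?F\<^esub> a \<in> word_class S ` ?W"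
        using inv[OF v(1)] by (simp add: inv_free_group inverse_word_in_lists)
      fix b assume "b \<in> word_class S ` ?W"
      then obtain w where w: "w \<in> ?W" "b = word_class S w" by blast
      with v show "a \<otimes>\<^bsub>?F\<^esub> b \<in> word_class S ` ?W"
        using equivclp_insertion_append[of _ v "[]" w "[]"] by (simp add: mult_free_group)
    qed
    fix a b assume "a \<in> carrier ?F" "b \<in> word_class S ` ?W"
    then obtain v w where v: "v \<in> lists (S \<times> UNIV)" "a = word_class S v"
      and w: "w \<in> ?W" "b = word_class S w" by (auto simp: carrier_free_group)
    let ?v' = "inverse_word v"
    have v': "?v' \<in> lists (S \<times> UNIV)" by (rule inverse_word_in_lists[OF v(1)])
    have "a \<otimes>\<^bsub>?F\<^esub> inv\<^bsub>?F\<^esub> a = \<one>\<^bsub>?F\<^esub>"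
      using v by (intro F.r_inv) (auto simp: carrier_free_group)
    with v v' have "(v @ ?v', []) \<in> free_equiv S"
      by (simp add: inv_free_group mult_free_group one_free_group word_class_eq_iff)
    then have "?eq (v @ ?v') []" by (rule free_equiv_imp_equivclp)
    moreover have "?eq (v @ w @ ?v') (v @ [] @ ?v')"
      using w by (intro equivclp_insertion_append_context) auto
    ultimately have "?eq (v @ w @ ?v') []"
      by (auto intro: equivclp_trans)
    with v v' w show "a \<otimes>\<^bsub>?F\<^esub> b \<otimes>\<^bsub>?F\<^esub> inv\<^bsub>?F\<^esub> a \<in> word_class S ` ?W"
      by (simp add: inv_free_group mult_free_group)
  qed
qed

text \<open>
  The map \<open>\<pi>\<close> evaluates words in the presented group. Inserting a relator preserves the value because
  relators have value one. Conversely, if \<open>v\<close> and \<open>w\<close> have the same value then \<open>v w\<inverse>\<close> is in the normal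
  closure, hence is connected with the empty word, so \<open>v\<close> is connected with \<open>v w\<inverse> w\<close> and with \<open>w\<close>.
\<close>

theorem presented_group_words:
  assumes R: "R \<subseteq> lists (S \<times> UNIV)"
  obtains \<pi> where "\<pi> ` lists (S \<times> UNIV) = carrier (presented_group S R)"
    and "\<And>v w. v \<in> lists (S \<times> UNIV) \<Longrightarrow> w \<in> lists (S \<times> UNIV) \<Longrightarrow>
      \<pi> (v @ w) = \<pi> v \<otimes>\<^bsub>presented_group S R\<^esub> \<pi> w"
    and "\<And>v w. v \<in> lists (S \<times> UNIV) \<Longrightarrow> w \<in> lists (S \<times> UNIV) \<Longrightarrow>
      \<pi> v = \<pi> w \<longleftrightarrow> equivclp (insertion (relators S R)) v w"
    and "group (presented_group S R)"
proof
  let ?F = "free_group S" and ?eq = "equivclp (insertion (relators S R))" and ?L = "lists (S \<times> UNIV)"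
  let ?N = "normal_closure ?F (word_class S ` R)"
  let ?P = "presented_group S R"
  let ?\<pi> = "\<lambda>w. ?N #>\<^bsub>?F\<^esub> word_class S w"
  have P: "?P = ?F Mod ?N"
    by (simp add: presented_group_def word_class_def)
  interpret F: group ?F by (rule group_free_group)
  interpret N: normal ?N ?F
    using R by (intro normal_normal_closure F.group_axioms) (auto simp: carrier_free_group)
  have cl: "word_class S w \<in> carrier ?F" if "w \<in> ?L" for w
    using that by (auto simp: carrier_free_group)
  show group: "group ?P" unfolding P by (rule N.factorgroup_is_group)
  interpret P: group ?P by fact
  show surj: "?\<pi> ` ?L = carrier ?P"
    unfolding P by (auto simp: FactGroup_def RCOSETS_def carrier_free_group)
  show hom: "?\<pi> (v @ w) = ?\<pi> v \<otimes>\<^bsub>?P\<^esub> ?\<pi> w" if "v \<in> ?L" "w \<in> ?L" for v w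
    using hom_mult[OF N.r_coset_hom_Mod cl[OF that(1)] cl[OF that(2)]] that
    unfolding P by (simp add: mult_free_group)
  have V: "relators S R \<subseteq> ?L"
    using R by (auto simp: relators_def)
  have trivial: "?\<pi> r = \<one>\<^bsub>?P\<^esub>" if "r \<in> relators S R" for r
  proof -
    have "word_class S r \<in> ?N"
      using that unfolding relators_def
    proof
      assume "r \<in> insert [] R"
      then show ?thesis
        using N.one_closed unfolding normal_closure_def one_free_group by blast
    next
      assume "r \<in> {[(s, b), (s, \<not> b)] |s b. s \<in> S}"
      then obtain s b where r: "r = [(s, b), (s, \<not> b)]" "s \<in> S" by blast
      with free_equiv.cancel[of "[]" S "[]" s b] have "word_class S r = \<one>\<^bsub>?F\<^esub>"
        by (simp add: one_free_group word_class_eq_iff)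
      then show ?thesis using N.one_closed by simp
    qed
    then have "?\<pi> r = ?N"
      using V that by (intro F.coset_join2 cl N.subgroup_axioms) auto
    then show ?thesis unfolding P by (simp add: FactGroup_def)
  qed
  have step_eq: "?\<pi> v = ?\<pi> w" if "insertion (relators S R) v w" "v \<in> ?L" for v w
  proof -
    from that(1) obtain x y r where r: "r \<in> relators S R" "v = x @ y" "w = x @ r @ y"
      unfolding insertion_def by blast
    have L: "x \<in> ?L" "y \<in> ?L" "r \<in> ?L" using that(2) r V by auto
    then have "?\<pi> x \<in> carrier ?P" "?\<pi> y \<in> carrier ?P" using surj by blast+
    with L r show ?thesis
      using trivial[OF r(1)] hom[of x "r @ y"] hom[of r y] hom[of x y] by simp
  qed
  show "?\<pi> v = ?\<pi> w \<longleftrightarrow> ?eq v w" if v: "v \<in> ?L" and w: "w \<in> ?L" for v w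
  proof
    assume "?eq v w"
    then have "w \<in> ?L \<and> ?\<pi> v = ?\<pi> w"
    proof (induction rule: equivclp_induct)
      case base
      then show ?case using v by simp
    next
      case (step u w)
      then show ?case
        using insertion_in_lists_iff[OF V, of u w] insertion_in_lists_iff[OF V, of w u]
          step_eq[of u w] step_eq[of w u] by auto
    qed
    then show "?\<pi> v = ?\<pi> w" by blast
  next
    let ?w' = "inverse_word w"
    have w': "?w' \<in> ?L" by (rule inverse_word_in_lists[OF w])
    assume "?\<pi> v = ?\<pi> w"
    then have "word_class S v \<in> ?N #>\<^bsub>?F\<^esub> word_class S w"
      using F.repr_independenceD[OF N.subgroup_axioms cl[OF v]] by simp
    from N.rcos_module_imp[OF F.group_axioms cl[OF w] this]
    have "word_class S (v @ ?w') \<in> ?N"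
      using v w w' by (simp add: inv_free_group mult_free_group)
    moreover have "R \<subseteq> {w \<in> ?L. ?eq w []}"
    proof
      fix r assume "r \<in> R"
      then have "insertion (relators S R) [] r"
        unfolding insertion_def relators_def by auto
      then show "r \<in> {w \<in> ?L. ?eq w []}"
        using R \<open>r \<in> R\<close> by (auto intro: equivclp_sym r_into_equivclp)
    qed
    then have "?N \<subseteq> word_class S ` {w \<in> ?L. ?eq w []}"
      unfolding normal_closure_def using normal_trivial_words by blast
    ultimately obtain u where u: "u \<in> ?L" "?eq u []" "word_class S (v @ ?w') = word_class S u"
      by blast
    then have "?eq (v @ ?w') u"
      using v w' by (intro free_equiv_imp_equivclp) (simp add: word_class_eq_iff)
    then have "?eq (v @ ?w') []"
      using u(2) by (rule equivclp_trans)
    then have "?eq ((v @ ?w') @ w) ([] @ w)"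
      by (rule equivclp_insertion_append[OF _ equivclp_refl])
    moreover have "?eq (v @ ?w' @ w) (v @ [])"
      using free_equiv_imp_equivclp[OF inverse_word_cancel[OF w]]
      by (rule equivclp_insertion_append[OF equivclp_refl])
    ultimately show "?eq v w"
      by (auto intro: equivclp_trans equivclp_sym)
  qed
qed


section \<open>Semideciding equality in a recursively presented group\<close>

text \<open>
  An insertion is a pair of a position and the index of a relator in the enumeration \<open>\<rho>\<close>. A position
  beyond the end of the word stands for its end.
\<close>

definition insert_all :: "(nat \<Rightarrow> 'l list) \<Rightarrow> 'l list \<Rightarrow> (nat \<times> nat) list \<Rightarrow> 'l list" where
  "insert_all \<rho> = foldl (\<lambda>w p. take (fst p) w @ \<rho> (snd p) @ drop (fst p) w)"

lemma computable_insert_all [computable_intros]: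
  assumes "computable \<rho>" "computable f" "computable g"
  shows "computable (\<lambda>x. insert_all \<rho> (f x) (g x))"
  unfolding insert_all_def
  by (intro computable_intros assms computable_comp[OF assms(1)])

lemma rtranclp_insertion_range_iff:
  "(insertion (range \<rho>))\<^sup>*\<^sup>* v w \<longleftrightarrow> (\<exists>d. insert_all \<rho> v d = w)"
proof
  assume "(insertion (range \<rho>))\<^sup>*\<^sup>* v w"
  then show "\<exists>d. insert_all \<rho> v d = w"
  proof (induction rule: rtranclp_induct)
    case base
    show ?case by (rule exI[of _ "[]"]) (simp add: insert_all_def)
  next
    case (step u w)
    then obtain d x y k where "insert_all \<rho> v d = x @ y" "w = x @ \<rho> k @ y"
      unfolding insertion_def by blast
    then have "insert_all \<rho> v (d @ [(length x, k)]) = w"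
      by (simp add: insert_all_def)
    then show ?case ..
  qed
next
  have "(insertion (range \<rho>))\<^sup>*\<^sup>* v (insert_all \<rho> v d)" for d
  proof (induction d rule: rev_induct)
    case (snoc p d)
    obtain i k where "p = (i, k)" by force
    let ?w = "insert_all \<rho> v d"
    have "insertion (range \<rho>) ?w (insert_all \<rho> v (d @ [p]))"
      unfolding insertion_def
      by (intro exI[of _ "take i ?w"] exI[of _ "drop i ?w"] exI[of _ "\<rho> k"])
        (simp add: insert_all_def \<open>p = (i, k)\<close>)
    with snoc show ?case by (rule rtranclp.rtrancl_into_rtrancl)
  qed (simp add: insert_all_def)
  then show "\<exists>d. insert_all \<rho> v d = w \<Longrightarrow> (insertion (range \<rho>))\<^sup>*\<^sup>* v w"
    by blast
qed

lemma equivclp_insertion_map: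
  assumes "equivclp (insertion V) v w"
  shows "equivclp (insertion (map f ` V)) (map f v) (map f w)"
  using assms
proof (induction rule: equivclp_induct)
  case (step u w)
  have "insertion (map f ` V) (map f a) (map f b)" if "insertion V a b" for a b
  proof -
    from that obtain x y r where "r \<in> V" "a = x @ y" "b = x @ r @ y"
      unfolding insertion_def by blast
    then show ?thesis
      unfolding insertion_def
      by (intro exI[of _ "map f x"] exI[of _ "map f y"] exI[of _ "map f r"]) simp
  qed
  with step show ?case
    by (blast intro: equivclp_trans equivclp_sym r_into_equivclp)
qed (rule equivclp_refl)

lemma equivclp_insertion_map_iff:
  assumes "inj f"
  shows "equivclp (insertion (map f ` V)) (map f v) (map f w) \<longleftrightarrow> equivclp (insertion V) v w"
proof
  assume "equivclp (insertion (map f ` V)) (map f v) (map f w)"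
  from equivclp_insertion_map[OF this, of "inv_into UNIV f"] assms
  show "equivclp (insertion V) v w"
    by (simp add: image_image inv_f_f comp_def)
qed (rule equivclp_insertion_map)

text \<open>
  The coding of letters underlying \<open>word_code\<close>.
\<close>

definition letter :: "nat \<times> bool \<Rightarrow> nat" where
  "letter l = 2 * fst l + of_bool (snd l)"

lemma inj_letter: "inj letter"
proof (rule injI)
  fix l m assume eq: "letter l = letter m"
  from arg_cong[OF eq, of even] have "snd l = snd m"
    by (cases "snd l"; cases "snd m") (simp_all add: letter_def)
  with eq show "l = m" by (simp add: letter_def prod_eq_iff)
qed

lemma word_code_eq_code: "word_code w = code (map letter w)"
  by (simp add: word_code_def code_list_def letter_def[abs_def] case_prod_unfold comp_def)

lemma enumerable_relators:
  assumes "re_set S" "re_set (word_code ` R)"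
  shows "enumerable (map letter ` relators S R)"
proof -
  have "code ` S = S" by (auto simp: image_iff)
  with assms(1) have S: "enumerable S"
    by (intro re_set_image_code_imp_enumerable) simp
  have "code ` map letter ` R = word_code ` R"
    by (simp add: image_image word_code_eq_code)
  with assms(2) have R: "enumerable (map letter ` R)"
    by (intro re_set_image_code_imp_enumerable) simp
  have "enumerable ({[]} \<union> map letter ` R \<union>
      ((\<lambda>s. [s + s + 1, s + s]) ` S \<union> (\<lambda>s. [s + s, s + s + 1]) ` S))" (is "enumerable ?V")
    by (intro enumerable_Un enumerable_singleton R enumerable_image[OF S] computable_intros)
  moreover have "?V = map letter ` relators S R"
  proof -
    have "{[(s, b), (s, \<not> b)] |s b. s \<in> S} =
        (\<lambda>s. [(s, True), (s, False)]) ` S \<union> (\<lambda>s. [(s, False), (s, True)]) ` S"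
      unfolding image_def Un_def by (auto intro: exI[of _ True] exI[of _ False])
    then show ?thesis
      by (simp add: relators_def image_Un image_image letter_def mult_2)
  qed
  ultimately show ?thesis by simp
qed

text \<open>
  All that is used of the presentation. Here \<open>W\<close> is the set of words over the presentation's generators,
  with letters coded as numbers, \<open>\<pi>\<close> is their evaluation in \<open>G\<close>, and \<open>E v w p\<close> states that \<open>p\<close>
  certifies the equality of \<open>v\<close> and \<open>w\<close>: the two lists of insertions in \<open>p\<close> lead from \<open>v\<close> and from \<open>w\<close> to the
  same word.
\<close>

theorem re_presentation_semidecides_equality:
  assumes "group G" "has_re_presentation G"
  obtains W :: "nat list set" and \<pi> :: "nat list \<Rightarrow> 'a"
    and E :: "nat list \<Rightarrow> nat list \<Rightarrow> (nat \<times> nat) list \<times> (nat \<times> nat) list \<Rightarrow> bool"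
  where "[] \<in> W" "\<And>v w. v \<in> W \<Longrightarrow> w \<in> W \<Longrightarrow> v @ w \<in> W"
    and "\<pi> ` W = carrier G" "\<pi> [] = \<one>\<^bsub>G\<^esub>"
    and "\<And>v w. v \<in> W \<Longrightarrow> w \<in> W \<Longrightarrow> \<pi> (v @ w) = \<pi> v \<otimes>\<^bsub>G\<^esub> \<pi> w"
    and "decidable (\<lambda>z. E (fst z) (fst (snd z)) (snd (snd z)))"
    and "\<And>v w. v \<in> W \<Longrightarrow> w \<in> W \<Longrightarrow> \<pi> v = \<pi> w \<longleftrightarrow> (\<exists>p. E v w p)"
proof -
  interpret G: group G by fact
  from assms(2) obtain S R where S: "re_set S" and R: "R \<subseteq> lists (S \<times> UNIV)" "re_set (word_code ` R)"
    and iso: "G \<cong> presented_group S R"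
    unfolding has_re_presentation_def by blast
  let ?L = "lists (S \<times> UNIV)" and ?P = "presented_group S R"
  obtain \<pi>\<^sub>0 where surj: "\<pi>\<^sub>0 ` ?L = carrier ?P"
    and hom: "\<And>v w. v \<in> ?L \<Longrightarrow> w \<in> ?L \<Longrightarrow> \<pi>\<^sub>0 (v @ w) = \<pi>\<^sub>0 v \<otimes>\<^bsub>?P\<^esub> \<pi>\<^sub>0 w"
    and eq: "\<And>v w. v \<in> ?L \<Longrightarrow> w \<in> ?L \<Longrightarrow> \<pi>\<^sub>0 v = \<pi>\<^sub>0 w \<longleftrightarrow> equivclp (insertion (relators S R)) v w"
    and P: "group ?P"
    by (rule presented_group_words[OF R(1)]) blast
  from group.iso_sym[OF assms(1) iso] obtain h where "h \<in> iso ?P G"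
    unfolding is_iso_def by blast
  then have h: "h ` carrier ?P = carrier G" "inj_on h (carrier ?P)" "h \<in> hom ?P G"
    by (auto simp: iso_iff)
  define \<pi> where "\<pi> w = h (\<pi>\<^sub>0 (map (inv_into UNIV letter) w))" for w
  have \<pi>: "\<pi> (map letter v) = h (\<pi>\<^sub>0 v)" for v
    by (simp add: \<pi>_def inv_f_f[OF inj_letter] comp_def)
  have mem: "\<pi>\<^sub>0 v \<in> carrier ?P" if "v \<in> ?L" for v
    using surj that by blast
  have "map letter ` relators S R \<noteq> {}" by (simp add: relators_def)
  with enumerable_relators[OF S R(2)] have "\<exists>\<rho> :: nat \<Rightarrow> nat list. computable \<rho> \<and> map letter ` relators S R = range \<rho>"
    unfolding enumerable_def by argo
  then obtain \<rho> :: "nat \<Rightarrow> nat list" where \<rho>: "computable \<rho>" "map letter ` relators S R = range \<rho>"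
    by (elim exE conjE)
  let ?E = "\<lambda>v w p. insert_all \<rho> v (fst p) = insert_all \<rho> w (snd p)"
  have app: "\<pi> (v @ w) = \<pi> v \<otimes>\<^bsub>G\<^esub> \<pi> w" if "v \<in> map letter ` ?L" "w \<in> map letter ` ?L" for v w
  proof -
    from that obtain v' w' where v': "v' \<in> ?L" "v = map letter v'" and w': "w' \<in> ?L" "w = map letter w'"
      by blast
    then have "\<pi> (v @ w) = h (\<pi>\<^sub>0 (v' @ w'))"
      using \<pi>[of "v' @ w'"] by simp
    with v' w' show ?thesis
      using hom_mult[OF h(3) mem[OF v'(1)] mem[OF w'(1)]] by (simp add: hom \<pi>)
  qed
  have img: "\<pi> ` map letter ` ?L = carrier G"
  proof -
    have "\<pi> ` map letter ` ?L = h ` \<pi>\<^sub>0 ` ?L" by (simp add: image_image \<pi>)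
    then show ?thesis by (simp only: surj h(1))
  qed
  have Nil: "[] \<in> map letter ` ?L" by (rule image_eqI[of _ _ "[]"]) simp_all
  have "\<pi> [] \<in> carrier G" using Nil img by blast
  with app[OF Nil Nil] have one: "\<pi> [] = \<one>\<^bsub>G\<^esub>"
    by simp
  have dec: "decidable (\<lambda>z. ?E (fst z) (fst (snd z)) (snd (snd z)))"
    by (intro computable_intros \<rho>(1))
  have eqv: "\<pi> v = \<pi> w \<longleftrightarrow> (\<exists>p. ?E v w p)" if "v \<in> map letter ` ?L" "w \<in> map letter ` ?L" for v w
  proof -
    from that obtain v' w' where v': "v' \<in> ?L" "v = map letter v'" and w': "w' \<in> ?L" "w = map letter w'"
      by blast
    have "\<pi> v = \<pi> w \<longleftrightarrow> \<pi>\<^sub>0 v' = \<pi>\<^sub>0 w'"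
      using v' w' mem h(2) by (simp add: \<pi> inj_on_eq_iff)
    also have "\<dots> \<longleftrightarrow> equivclp (insertion (range \<rho>)) v w"
      using v' w' by (simp add: eq equivclp_insertion_map_iff[OF inj_letter] flip: \<rho>(2))
    also have "\<dots> \<longleftrightarrow> (\<exists>p. ?E v w p)"
      unfolding equivclp_insertion_iff rtranclp_insertion_range_iff split_paired_Ex fst_conv snd_conv
      by metis
    finally show ?thesis .
  qed
  have closed: "v @ w \<in> map letter ` ?L" if "v \<in> map letter ` ?L" "w \<in> map letter ` ?L" for v w
  proof -
    from that obtain v' w' where "v' \<in> ?L" "v = map letter v'" "w' \<in> ?L" "w = map letter w'"
      by blast
    then show ?thesis by (intro image_eqI[of _ _ "v' @ w'"]) simp_all
  qed
  show thesis
    by (rule that[of "map letter ` ?L" \<pi> ?E])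
      (rule Nil closed img one app dec eqv; assumption?)+
qed


section \<open>Deciding the word problem\<close>

lemma (in group) word_value_closed: "w \<in> lists (carrier G) \<Longrightarrow> word_value G w \<in> carrier G"
  by (induction w) (simp_all add: word_value_def)

lemma (in group) word_value_append:
  "v \<in> lists (carrier G) \<Longrightarrow> w \<in> lists (carrier G) \<Longrightarrow>
    word_value G (v @ w) = word_value G v \<otimes> word_value G w"
  by (induction v) (use word_value_closed in \<open>auto simp: word_value_def m_assoc\<close>)

lemma (in group) word_value_surj:
  assumes "finite_symmetric_generating_set G X" "g \<in> carrier G"
  obtains w where "w \<in> lists X" "word_value G w = g"
proof -
  have X: "X \<subseteq> carrier G" "\<And>x. x \<in> X \<Longrightarrow> inv x \<in> X" "generate G X = carrier G"
    using assms(1) by (auto simp: finite_symmetric_generating_set_def)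
  have "g \<in> generate G X" using assms(2) X(3) by simp
  then have "\<exists>w\<in>lists X. word_value G w = g"
  proof induction
    case one
    show ?case by (rule bexI[of _ "[]"]) (simp_all add: word_value_def)
  next
    case (incl h)
    with X(1) show ?case by (intro bexI[of _ "[h]"]) (auto simp: word_value_def)
  next
    case (inv h)
    with X(1,2) show ?case by (intro bexI[of _ "[inv h]"]) (auto simp: word_value_def)
  next
    case (eng h1 h2)
    then obtain w1 w2 where "w1 \<in> lists X" "word_value G w1 = h1" "w2 \<in> lists X" "word_value G w2 = h2"
      by blast
    then show ?case
      using word_value_append[of w1 w2] lists_mono[OF X(1)] by (intro bexI[of _ "w1 @ w2"]) auto
  qed
  then show thesis using that by blast
qed

lemma (in group) geodesic_exists:
  assumes "finite_symmetric_generating_set G X" "g \<in> carrier G"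
  obtains u where "u \<in> Geo G X" "word_value G u = g"
proof -
  obtain w where "w \<in> lists X \<and> word_value G w = g"
    using word_value_surj[OF assms] by blast
  from ex_has_least_nat[of "\<lambda>w. w \<in> lists X \<and> word_value G w = g", OF this, of length]
  obtain u where u: "u \<in> lists X" "word_value G u = g"
    "\<And>v. v \<in> lists X \<Longrightarrow> word_value G v = g \<Longrightarrow> length u \<le> length v"
    by blast
  then have "u \<in> Geo G X"
    unfolding Geo_def by (auto simp: not_less)
  with u(2) show thesis by (rule that[rotated])
qed

lemma geodesic_one_iff: "u \<in> Geo G X \<Longrightarrow> word_value G u = \<one>\<^bsub>G\<^esub> \<longleftrightarrow> u = []"
  unfolding Geo_def by (fastforce simp: word_value_def intro: bexI[of _ "[]"])

text \<open>
  The translation is a homomorphism of words: each of the finitely many letters is replaced by a fixed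
  word with the same value. Numbers that are not letters are deleted, so the result is in \<open>W\<close> for all
  inputs; this keeps the search total on inputs that do not code words over \<open>Y\<close>.
\<close>

lemma computable_word_translation:
  fixes \<pi> :: "nat list \<Rightarrow> 'a"
  assumes W: "[] \<in> W" "\<And>v w. v \<in> W \<Longrightarrow> w \<in> W \<Longrightarrow> v @ w \<in> W"
    and \<pi>: "\<pi> ` W = carrier G" "\<pi> [] = \<one>\<^bsub>G\<^esub>"
      "\<And>v w. v \<in> W \<Longrightarrow> w \<in> W \<Longrightarrow> \<pi> (v @ w) = \<pi> v \<otimes>\<^bsub>G\<^esub> \<pi> w"
    and e: "bij_betw e Y {..<n}" "Y \<subseteq> carrier G"
  shows "\<exists>\<phi> :: nat list \<Rightarrow> nat list. computable \<phi> \<and> (\<forall>w. \<phi> w \<in> W) \<and>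
    (\<forall>w\<in>lists Y. \<pi> (\<phi> (map e w)) = word_value G w)"
proof -
  let ?t = "\<lambda>k. if k < n then inv_into W \<pi> (inv_into Y e k) else []"
  let ?\<phi> = "\<lambda>w. concat (map ?t w)"
  have "computable ?t"
    by (rule computable_finite_table[of n _ "[]"]) simp
  then have "computable (\<lambda>z. ?t (snd z))"
    by (rule computable_comp) (intro computable_intros)
  then have comp: "computable ?\<phi>"
    by (intro computable_concat_map computable_ident)
  have Y: "inv_into Y e k \<in> carrier G" if "k < n" for k
    using that e by (metis bij_betw_def inv_into_into lessThan_iff subsetD)
  have t: "?t k \<in> W" for k
    using Y[of k] W(1) by (auto simp: \<pi>(1)[symmetric] intro: inv_into_into)
  then have \<phi>: "?\<phi> w \<in> W" for w
    by (induction w) (simp_all add: W del: if_split)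
  have "\<pi> (?\<phi> (map e w)) = word_value G w" if "w \<in> lists Y" for w
    using that
  proof (induction w)
    case Nil
    show ?case by (simp add: \<pi>(2) word_value_def)
  next
    case (Cons y w)
    then have "e y < n" "inv_into Y e (e y) = y" "y \<in> \<pi> ` W"
      using e \<pi>(1) by (auto simp: bij_betw_def)
    then have "\<pi> (?t (e y)) = y" by (simp add: f_inv_into_f)
    then show ?case
      using Cons \<pi>(3)[OF t \<phi>, of "e y" "map e w"] by (simp add: word_value_def)
  qed
  with comp \<phi> show ?thesis
    by (intro exI[of _ ?\<phi>] conjI allI ballI)
qed

lemma code_nat_list: "code (w :: nat list) = list_encode w"
  by (simp add: code_list_def code_nat_def[abs_def])

lemma recursive_language_iff:
  "recursive_language X L \<longleftrightarrow> L \<subseteq> lists X \<and>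
    (\<exists>e. bij_betw e X {..<card X} \<and> decidable (\<lambda>w. w \<in> map e ` L))"
proof -
  have "(\<lambda>w. list_encode (map e w)) ` L = code ` map e ` L" for e
    by (simp add: image_image code_nat_list)
  then show ?thesis
    unfolding recursive_language_def by (simp add: recursive_set_image_code_iff)
qed

text \<open>
  The search described at the beginning. On inputs that do not code words over \<open>Y\<close> it also ends, with a
  meaningless result; these inputs are rejected by a separate test of their letters.
\<close>

lemma recursive_word_problem:
  fixes G :: "('a, 'b) monoid_scheme"
  assumes "group G" "has_re_presentation G"
    and X: "finite_symmetric_generating_set G X" "recursive_language X (Geo G X)"
    and Y: "finite Y" "Y \<subseteq> carrier G"
  shows "recursive_language Y (word_problem G Y)"
proof -
  interpret group G by fact
  obtain W :: "nat list set" and \<pi> :: "nat list \<Rightarrow> 'a"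
    and E :: "nat list \<Rightarrow> nat list \<Rightarrow> (nat \<times> nat) list \<times> (nat \<times> nat) list \<Rightarrow> bool"
    where W: "[] \<in> W" "\<And>v w. v \<in> W \<Longrightarrow> w \<in> W \<Longrightarrow> v @ w \<in> W"
    and \<pi>: "\<pi> ` W = carrier G" "\<pi> [] = \<one>\<^bsub>G\<^esub>"
      "\<And>v w. v \<in> W \<Longrightarrow> w \<in> W \<Longrightarrow> \<pi> (v @ w) = \<pi> v \<otimes>\<^bsub>G\<^esub> \<pi> w"
    and E: "decidable (\<lambda>z. E (fst z) (fst (snd z)) (snd (snd z)))"
      "\<And>v w. v \<in> W \<Longrightarrow> w \<in> W \<Longrightarrow> \<pi> v = \<pi> w \<longleftrightarrow> (\<exists>p. E v w p)"
    by (rule re_presentation_semidecides_equality[OF assms(1,2)]) blast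
  from X(2) obtain e\<^sub>X where e\<^sub>X: "bij_betw e\<^sub>X X {..<card X}"
    and geo: "decidable (\<lambda>w. w \<in> map e\<^sub>X ` Geo G X)"
    unfolding recursive_language_iff by blast
  from ex_bij_betw_finite_nat[OF Y(1)] obtain e where e: "bij_betw e Y {..<card Y}"
    by (auto simp: lessThan_atLeast0)
  have X': "X \<subseteq> carrier G" using X(1) by (simp add: finite_symmetric_generating_set_def)
  obtain \<phi>\<^sub>X where \<phi>\<^sub>X: "computable \<phi>\<^sub>X" "\<And>w. \<phi>\<^sub>X w \<in> W"
    "\<And>w. w \<in> lists X \<Longrightarrow> \<pi> (\<phi>\<^sub>X (map e\<^sub>X w)) = word_value G w"
    using computable_word_translation[OF W \<pi> e\<^sub>X X'] by auto
  obtain \<phi> where \<phi>: "computable \<phi>" "\<And>w. \<phi> w \<in> W"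
    "\<And>w. w \<in> lists Y \<Longrightarrow> \<pi> (\<phi> (map e w)) = word_value G w"
    using computable_word_translation[OF W \<pi> e Y(2)] by auto
  let ?P = "\<lambda>w c. fst c \<in> map e\<^sub>X ` Geo G X \<and> E (\<phi> w) (\<phi>\<^sub>X (fst c)) (snd c)"
  have "decidable (\<lambda>z. ?P (fst z) (snd z))"
  proof (intro decidable_conj)
    have "computable (\<lambda>z :: nat list \<times> nat list \<times> (nat \<times> nat) list \<times> (nat \<times> nat) list.
        (\<phi> (fst z), (\<phi>\<^sub>X (fst (snd z)), snd (snd z))))"
      by (intro computable_intros computable_comp[OF \<phi>(1)] computable_comp[OF \<phi>\<^sub>X(1)])
    from decidable_comp[OF E(1) this]
    show "decidable (\<lambda>z. E (\<phi> (fst z)) (\<phi>\<^sub>X (fst (snd z))) (snd (snd z)))" by simp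
  qed (intro decidable_comp[OF geo] computable_intros)
  moreover have "\<exists>c. ?P w c" for w
  proof -
    have "\<pi> (\<phi> w) \<in> carrier G" using \<phi>(2)[of w] \<pi>(1) by blast
    then obtain u where u: "u \<in> Geo G X" "word_value G u = \<pi> (\<phi> w)"
      using geodesic_exists[OF X(1)] by blast
    then have "\<pi> (\<phi> w) = \<pi> (\<phi>\<^sub>X (map e\<^sub>X u))"
      using \<phi>\<^sub>X(3)[of u] by (simp add: Geo_def)
    with E(2)[OF \<phi>(2) \<phi>\<^sub>X(2)] obtain p where "E (\<phi> w) (\<phi>\<^sub>X (map e\<^sub>X u)) p" by blast
    with u(1) show ?thesis by (intro exI[of _ "(map e\<^sub>X u, p)"]) auto
  qed
  ultimately obtain f where f: "computable f" "\<And>w. ?P w (f w)"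
    using computable_choice[of ?P] by blast
  have decides: "word_value G w = \<one>\<^bsub>G\<^esub> \<longleftrightarrow> fst (f (map e w)) = []" if w: "w \<in> lists Y" for w
  proof -
    from f(2)[of "map e w"] obtain u where u: "u \<in> Geo G X" "fst (f (map e w)) = map e\<^sub>X u"
      "E (\<phi> (map e w)) (\<phi>\<^sub>X (map e\<^sub>X u)) (snd (f (map e w)))" by auto
    have "u \<in> lists X" using u(1) by (simp add: Geo_def)
    then have "word_value G w = word_value G u"
      using E(2)[OF \<phi>(2) \<phi>\<^sub>X(2)] u(3) \<phi>(3)[OF w] \<phi>\<^sub>X(3) by metis
    then show ?thesis using geodesic_one_iff[OF u(1)] u(2) by simp
  qed
  have "decidable (\<lambda>w. set w \<subseteq> {..<card Y} \<and> fst (f w) = [])"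
    by (intro computable_intros decidable_set_subset_lessThan f(1))
  moreover have "set w \<subseteq> {..<card Y} \<and> fst (f w) = [] \<longleftrightarrow> w \<in> map e ` word_problem G Y" for w
  proof -
    have "{w. set w \<subseteq> {..<card Y}} = lists (e ` Y)"
      using e by (auto simp: bij_betw_def lists_eq_set)
    then have "set w \<subseteq> {..<card Y} \<longleftrightarrow> w \<in> map e ` lists Y"
      by (auto simp: lists_image)
    moreover have "word_problem G Y = {w \<in> lists Y. fst (f (map e w)) = []}"
      using decides by (auto simp: word_problem_def)
    ultimately show ?thesis by auto
  qed
  ultimately have "decidable (\<lambda>w. w \<in> map e ` word_problem G Y)"
    by simp
  with e show ?thesis
    unfolding recursive_language_iff by (auto simp: word_problem_def)
qed

theorem proposition1p1:
  fixes G :: "('a, 'b) monoid_scheme" and X :: "'a set"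
  assumes "group G"
    and "finite_symmetric_generating_set G X"
    and "recursive_language X (Geo G X)"
    and "has_re_presentation G"
  shows "solvable_word_problem G"
  unfolding solvable_word_problem_def
proof (intro conjI exI allI impI)
  show "finite_symmetric_generating_set G X" by fact
  fix Y assume "finite_symmetric_generating_set G Y"
  then have "finite Y" "Y \<subseteq> carrier G"
    by (auto simp: finite_symmetric_generating_set_def)
  with assms show "recursive_language Y (word_problem G Y)"
    by (intro recursive_word_problem)
qed

end
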